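(* Let $\mathbb{F}$ be a finite field and let $(Q_n)_{n \in \mathbb{N}}$ be a sequence of monic polynomials in $\mathbb{F}[t]$. The following are equivalent: (i) For every $m \in \mathbb{F}[t] \setminus \{0\}$, \[ \sup_{f_n : \mathbb{F}[t]_{Q_n} \to \mathbb{D}} \left\| \mathbb{E}_{y \in \mathbb{F}[t]_{Q_n}} f_n(x+my) - \mathbb{E}_{z \in \mathbb{F}[t]_{Q_n}} f_n(z) \right\|_{L^2(\mathbb{F}[t]_{Q_n})} \longrightarrow 0 \quad (n \to \infty), \] where the $L^2$ norm is taken in the variable $x \in \mathbb{F}[t]_{Q_n}$ and $\mathbb{D}=\{w\in\mathbb{C}:|w|\le 1\}$. (ii) $\mathrm{lpf}(Q_n) \to \infty$ as $n \to \infty$.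
   Context: For $Q \in \mathbb{F}[t]$ monic, $\mathbb{F}[t]_Q$ denotes the quotient ring $\mathbb{F}[t]/Q\mathbb{F}[t]$. The absolute value on $\mathbb{F}[t]$ is $|Q| = |\mathbb{F}|^{\deg Q}$ for $Q\neq 0$ (equivalently $|Q| = |\mathbb{F}[t]_Q|$). If $Q = Q_1^{s_1}\cdots Q_r^{s_r}$ is the factorization of $Q$ into distinct monic irreducibles, $\mathrm{lpf}(Q) = \min_{1\le i\le r}|Q_i|$. For a finite set $S$ and $f:S\to\mathbb{C}$, $\mathbb{E}_{x\in S} f(x) = \frac{1}{|S|}\sum_{x\in S} f(x)$ and $\|f\|_{L^r(S)} = (\mathbb{E}_{x\in S}|f(x)|^r)^{1/r}$. *)

theory Defs
  imports
    "HOL-Analysis.Analysis"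
    "HOL-Computational_Algebra.Computational_Algebra"
    "HOL-Algebra.Algebraic_Closure_Type"
begin

hide_const (open) Polynomials.degree Polynomials.lead_coeff
  up_ring.coeff Divisibility.irreducible Divisibility.prime

definition poly_abs :: "'a :: {field, finite} poly \<Rightarrow> real" where
  "poly_abs Q = (if Q = 0 then 0 else real CARD('a) ^ degree Q)"

text \<open>
  The distinct monic irreducible factors of \<open>Q\<close> are its monic irreducible divisors.
  The infimum is taken in the extended reals, so that \<open>lpf 1 = \<infinity>\<close>, the minimum of an empty
  set of absolute values.
\<close>

definition lpf :: "'a :: {field, finite} poly \<Rightarrow> ereal" where
  "lpf Q = (INF P \<in> {P. lead_coeff P = 1 \<and> irreducible P \<and> P dvd Q}. ereal (poly_abs P))"

lemma lpf_one: "lpf 1 = \<infinity>"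
proof -
  have *: "{P :: 'a poly. lead_coeff P = 1 \<and> irreducible P \<and> P dvd 1} = {}"
    by (auto simp: Factorial_Ring.irreducible_def)
  then show ?thesis
    unfolding lpf_def * by (simp add: top_ereal_def)
qed

lemma lpf_prod_irreducible_powers:
  fixes S :: "'a :: {field, finite} poly set" and s :: "'a poly \<Rightarrow> nat"
  assumes "finite S" "S \<noteq> {}"
    and irred: "\<And>P. P \<in> S \<Longrightarrow> lead_coeff P = 1 \<and> irreducible P \<and> s P > 0"
  shows "lpf (\<Prod>P\<in>S. P ^ s P) = ereal (Min (poly_abs ` S))"
proof -
  have "R \<in> S" if R: "lead_coeff R = 1" "irreducible R" "R dvd (\<Prod>P\<in>S. P ^ s P)" for R
  proof -
    have pR: "prime_elem R"
      using R(2) by (rule field_poly_irreducible_imp_prime)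
    have "\<exists>P\<in>S. R dvd P ^ s P"
      using \<open>finite S\<close> R(3)
    proof (induction S rule: finite_induct)
      case empty
      then show ?case
        using R(2) by (simp add: Factorial_Ring.irreducible_def)
    next
      case (insert P S)
      from insert.prems have "R dvd P ^ s P * (\<Prod>P\<in>S. P ^ s P)"
        by (simp only: prod.insert[OF insert.hyps])
      with pR have "R dvd P ^ s P \<or> R dvd (\<Prod>P\<in>S. P ^ s P)"
        by (rule prime_elem_dvd_multD)
      with insert.IH show ?case by auto
    qed
    then obtain P where P: "P \<in> S" "R dvd P ^ s P" ..
    have "R dvd P"
      using pR P(2) by (rule prime_elem_dvd_power)
    moreover have "\<not> is_unit R"
      using R(2) by (auto simp: Factorial_Ring.irreducible_def)
    ultimately have "P dvd R"
      using irred[OF P(1)] irreducibleD'[of P R] \<open>R dvd P\<close> by simp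
    have monic_P: "lead_coeff P = 1"
      using irred[OF P(1)] by simp
    obtain c where c: "P = R * c"
      using \<open>R dvd P\<close> by blast
    with monic_P have nz: "R \<noteq> 0" "c \<noteq> 0" by auto
    have "degree P \<le> degree R"
      using dvd_imp_degree_le[OF \<open>P dvd R\<close> nz(1)] .
    with c nz have "degree c = 0" by (simp add: degree_mult_eq)
    then obtain a where a: "c = [:a:]" by (rule degree_eq_zeroE)
    have "a = 1"
      using monic_P R(1) unfolding c lead_coeff_mult a by simp
    then have "P = R"
      by (simp add: c a)
    with P(1) show ?thesis by simp
  qed
  moreover have "P dvd (\<Prod>P\<in>S. P ^ s P)" if "P \<in> S" for P
  proof (rule dvd_trans)
    show "P dvd P ^ s P"
      using irred[OF that] by (intro dvd_power) simp
    show "P ^ s P dvd (\<Prod>P\<in>S. P ^ s P)"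
      using \<open>finite S\<close> that by (rule dvd_prodI)
  qed
  ultimately have eq: "{R. lead_coeff R = 1 \<and> irreducible R \<and> R dvd (\<Prod>P\<in>S. P ^ s P)} = S"
    using irred by (intro equalityI subsetI) simp_all
  show ?thesis
    unfolding lpf_def eq
  proof (rule antisym)
    have "Min (poly_abs ` S) \<in> poly_abs ` S"
      using assms(1,2) by simp
    then obtain P where "P \<in> S" "Min (poly_abs ` S) = poly_abs P" by blast
    then show "(INF P\<in>S. ereal (poly_abs P)) \<le> ereal (Min (poly_abs ` S))"
      by (auto intro: INF_lower)
    show "ereal (Min (poly_abs ` S)) \<le> (INF P\<in>S. ereal (poly_abs P))"
      using assms(1) by (auto intro!: INF_greatest)
  qed
qed

text \<open>
  The quotient ring \<open>F[t]/QF[t]\<close>, whose elements are the cosets of the ideal generated by \<open>Q\<close>.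
\<close>

definition poly_ideal :: "'a :: {field, finite} poly \<Rightarrow> 'a poly set" where
  "poly_ideal Q = PIdl\<^bsub>ring_of_type_algebra\<^esub> Q"

definition poly_quot :: "'a :: {field, finite} poly \<Rightarrow> 'a poly set ring" where
  "poly_quot Q = ring_of_type_algebra Quot poly_ideal Q"

definition poly_class :: "'a :: {field, finite} poly \<Rightarrow> 'a poly \<Rightarrow> 'a poly set" where
  "poly_class Q m = poly_ideal Q +>\<^bsub>ring_of_type_algebra\<^esub> m"

definition average :: "'s set \<Rightarrow> ('s \<Rightarrow> 'b :: real_normed_field) \<Rightarrow> 'b" where
  "average S f = (\<Sum>x\<in>S. f x) / of_nat (card S)"

definition Lnorm :: "real \<Rightarrow> 's set \<Rightarrow> ('s \<Rightarrow> complex) \<Rightarrow> real" where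
  "Lnorm r S f = average S (\<lambda>x. cmod (f x) powr r) powr (1 / r)"

end

theory Submission
  imports Defs
begin

text \<open>
  If \<open>lpf Q > |m|\<close>, then \<open>m\<close> is invertible modulo \<open>Q\<close>, so \<open>y \<mapsto> x + m y\<close> permutes the quotient
  ring and both averages agree. Conversely, given \<open>C\<close>, let \<open>m\<close> be the product of all irreducible
  polynomials of absolute value at most \<open>C\<close>. If \<open>Q\<close> has such a factor, the multiples of \<open>m\<close> form a
  proper ideal modulo \<open>Q\<close>, of density at least \<open>1 / |m|\<close>. Its indicator function is invariant under
  \<open>x \<mapsto> x + m y\<close> and hence stays at a distance from its mean bounded below independently of \<open>Q\<close>.
\<close>

section \<open>Polynomials over a finite field\<close>

lemma finite_degree_less: "finite {p :: 'a :: {zero, finite} poly. Polynomial.degree p < n}"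
proof (rule finite_subset)
  show "{p :: 'a poly. Polynomial.degree p < n} \<subseteq> Poly ` {xs. set xs \<subseteq> UNIV \<and> length xs \<le> n}"
  proof
    fix p :: "'a poly"
    assume "p \<in> {p. Polynomial.degree p < n}"
    then have "length (coeffs p) \<le> n"
      by (cases "p = 0") (auto simp: length_coeffs)
    moreover have "p = Poly (coeffs p)" by simp
    ultimately show "p \<in> Poly ` {xs. set xs \<subseteq> UNIV \<and> length xs \<le> n}" by blast
  qed
  show "finite (Poly ` {xs :: 'a list. set xs \<subseteq> UNIV \<and> length xs \<le> n})"
    by (intro finite_imageI finite_lists_length_le) simp
qed

lemma one_less_CARD_field: "1 < real CARD('a :: {field, finite})"
proof -
  have "card {0 :: 'a, 1} \<le> CARD('a)" by (intro card_mono) auto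
  then show ?thesis by simp
qed

text \<open>Bounded absolute value means bounded degree, as \<open>CARD('a) > 1\<close>. Finiteness
  makes the product of all irreducibles up to a given absolute value a genuine polynomial.\<close>

lemma finite_poly_abs_le: "finite {p :: 'a :: {field, finite} poly. poly_abs p \<le> C}"
proof -
  obtain n where n: "C < real CARD('a) ^ n"
    using one_less_CARD_field real_arch_pow by blast
  have "Polynomial.degree p < n" if "poly_abs p \<le> C" "p \<noteq> 0" for p :: "'a poly"
  proof -
    have "real CARD('a) ^ Polynomial.degree p < real CARD('a) ^ n"
      using that n by (simp add: poly_abs_def)
    then show ?thesis by (metis one_less_CARD_field power_less_imp_less_exp)
  qed
  then have "{p :: 'a poly. poly_abs p \<le> C} \<subseteq> insert 0 {p. Polynomial.degree p < n}" by auto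
  then show ?thesis by (rule finite_subset) (simp add: finite_degree_less)
qed

lemma poly_abs_dvd_le:
  assumes "p dvd q" "q \<noteq> 0"
  shows "poly_abs p \<le> poly_abs q"
proof -
  have "p \<noteq> 0" using assms by auto
  then show ?thesis
    using dvd_imp_degree_le[OF assms] assms(2) one_less_CARD_field[where 'a = 'a]
    by (simp add: poly_abs_def power_increasing)
qed

text \<open>Descent on the degree: a reducible polynomial has a nonconstant factor of smaller
  degree, and an irreducible one is rescaled by its leading coefficient, since \<open>lpf\<close>
  ranges over monic factors only.\<close>

lemma monic_irreducible_divisor_exists:
  fixes p :: "'a :: field poly"
  assumes "0 < Polynomial.degree p"
  shows "\<exists>q. Polynomial.lead_coeff q = 1 \<and> irreducible q \<and> q dvd p"
  using assms
proof (induction "Polynomial.degree p" arbitrary: p rule: less_induct)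
  case less
  have "p \<noteq> 0" using less.prems by auto
  with less.prems have p: "p \<noteq> 0" "\<not> is_unit p" by (simp_all add: is_unit_iff_degree)
  show ?case
  proof (cases "irreducible p")
    case True
    define c where "c = inverse (Polynomial.lead_coeff p)"
    have "c \<noteq> 0" using p by (simp add: c_def)
    then have "is_unit [:c:]" by (simp add: is_unit_const_poly_iff dvd_field_iff)
    then have "irreducible ([:c:] * p)" using True irreducible_mult_unit_left by blast
    moreover have "Polynomial.lead_coeff (Polynomial.smult c p) = 1" using p by (simp add: c_def)
    moreover have "Polynomial.smult c p dvd p" using \<open>c \<noteq> 0\<close> by (simp add: smult_dvd_iff)
    ultimately show ?thesis by (intro exI[of _ "Polynomial.smult c p"]) simp
  next
    case False
    then obtain a b where ab: "p = a * b" "\<not> is_unit a" "\<not> is_unit b"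
      using p by (auto simp: Factorial_Ring.irreducible_def)
    with p have "a \<noteq> 0" "b \<noteq> 0" by auto
    with ab have "0 < Polynomial.degree a" "Polynomial.degree a < Polynomial.degree p"
      by (auto simp: is_unit_iff_degree degree_mult_eq)
    from less.hyps[OF this(2,1)] ab(1) show ?thesis by (meson dvd_mult2)
  qed
qed

text \<open>Irreducible factors are peeled off \<open>Q\<close> one at a time: such a
  \<open>P\<close> is prime and does not divide \<open>m\<close>, so it divides \<open>p\<close>,
  and cancelling it lowers the degree of \<open>Q\<close>.\<close>

lemma dvd_mult_cancel_no_common_factor:
  fixes Q m p :: "'a :: field poly"
  assumes "Q \<noteq> 0" "Q dvd m * p"
    and "\<And>P. Polynomial.lead_coeff P = 1 \<Longrightarrow> irreducible P \<Longrightarrow> P dvd Q \<Longrightarrow> \<not> P dvd m"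
  shows "Q dvd p"
  using assms
proof (induction "Polynomial.degree Q" arbitrary: Q p rule: less_induct)
  case less
  show ?case
  proof (cases "Polynomial.degree Q = 0")
    case True
    then show ?thesis using less.prems(1) by (simp add: is_unit_iff_degree unit_imp_dvd)
  next
    case False
    then obtain P where P: "Polynomial.lead_coeff P = 1" "irreducible P" "P dvd Q"
      using monic_irreducible_divisor_exists by blast
    have prime: "prime_elem P" using P(2) by (rule field_poly_irreducible_imp_prime)
    have "P dvd p"
      using prime_elem_dvd_multD[OF prime] dvd_trans[OF P(3) less.prems(2)] less.prems(3)[OF P]
      by blast
    then obtain p' where p': "p = P * p'" by blast
    obtain Q' where Q': "Q = P * Q'" using P(3) by blast
    have nz: "P \<noteq> 0" "Q' \<noteq> 0" using less.prems(1) Q' by auto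
    have "0 < Polynomial.degree P"
      using P(2) nz(1) irreducible_not_unit[OF P(2)] by (auto simp: is_unit_iff_degree)
    then have "Polynomial.degree Q' < Polynomial.degree Q"
      using nz by (simp add: Q' degree_mult_eq)
    moreover have "P * Q' dvd P * (m * p')"
      using less.prems(2) by (simp add: Q' p' mult.left_commute)
    then have "Q' dvd m * p'" using nz(1) by simp
    ultimately have "Q' dvd p'"
      using less.hyps[of Q' p'] nz(2) less.prems(3) unfolding Q' by (meson dvd_mult)
    then show ?thesis by (simp add: Q' p' mult_dvd_mono)
  qed
qed

lemma less_lpfD:
  assumes "ereal C < lpf Q" "Polynomial.lead_coeff P = 1" "irreducible P" "P dvd Q"
  shows "C < poly_abs P"
proof -
  have "lpf Q \<le> ereal (poly_abs P)"
    unfolding lpf_def using assms(2-) by (intro INF_lower) auto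
  with assms(1) have "ereal C < ereal (poly_abs P)" by (rule less_le_trans)
  then show ?thesis by simp
qed


section \<open>The quotient ring\<close>

lemma ring_of_type_algebra_simps [simp]:
  "carrier ring_of_type_algebra = UNIV"
  "x \<otimes>\<^bsub>ring_of_type_algebra\<^esub> y = x * y"
  "x \<oplus>\<^bsub>ring_of_type_algebra\<^esub> y = x + y"
  "\<one>\<^bsub>ring_of_type_algebra\<^esub> = 1"
  "\<zero>\<^bsub>ring_of_type_algebra\<^esub> = 0"
  by (simp_all add: ring_of_type_algebra_def)

lemma ideal_poly_ideal: "ideal (poly_ideal Q) ring_of_type_algebra"
  unfolding poly_ideal_def by (intro cring.cgenideal_ideal cring_from_type_algebra) simp

lemma mem_poly_ideal_iff: "p \<in> poly_ideal Q \<longleftrightarrow> Q dvd p"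
  by (auto simp: poly_ideal_def cgenideal_def dvd_def mult.commute)

lemma cring_poly_quot: "cring (poly_quot Q)"
  unfolding poly_quot_def
  by (intro ideal.quotient_is_cring ideal_poly_ideal cring_from_type_algebra)

lemma poly_class_ring_hom: "poly_class Q \<in> ring_hom ring_of_type_algebra (poly_quot Q)"
  using ideal.rcos_ring_hom[OF ideal_poly_ideal[of Q]]
  unfolding poly_quot_def poly_class_def [abs_def] .

lemma poly_class_mult: "poly_class Q (p * q) = poly_class Q p \<otimes>\<^bsub>poly_quot Q\<^esub> poly_class Q q"
  using ring_hom_mult[OF poly_class_ring_hom, of p q] by simp

lemma poly_class_add: "poly_class Q (p + q) = poly_class Q p \<oplus>\<^bsub>poly_quot Q\<^esub> poly_class Q q"
  using ring_hom_add[OF poly_class_ring_hom, of p q] by simp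

lemma poly_class_one: "poly_class Q 1 = \<one>\<^bsub>poly_quot Q\<^esub>"
  using ring_hom_one[OF poly_class_ring_hom, of Q] by simp

lemma carrier_poly_quot: "carrier (poly_quot Q) = range (poly_class Q)"
  by (auto simp: poly_quot_def poly_class_def FactRing_def A_RCOSETS_def')

lemma poly_class_eq_iff: "poly_class Q p = poly_class Q q \<longleftrightarrow> Q dvd p - q"
proof -
  have mem: "r \<in> poly_class Q s \<longleftrightarrow> Q dvd r - s" for r s
  proof -
    have "r \<in> poly_class Q s \<longleftrightarrow> (\<exists>i. Q dvd i \<and> r = i + s)"
      by (auto simp: poly_class_def a_r_coset_def' mem_poly_ideal_iff)
    then show ?thesis by (metis add_diff_cancel diff_add_cancel)
  qed
  show ?thesis
  proof
    assume "poly_class Q p = poly_class Q q"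
    then show "Q dvd p - q" using mem[of p p] mem[of p q] by simp
  next
    assume *: "Q dvd p - q"
    have "Q dvd r - p \<longleftrightarrow> Q dvd r - q" for r
      using dvd_add_left_iff[OF *, of "r - p"] by simp
    then show "poly_class Q p = poly_class Q q" using mem by blast
  qed
qed

lemma finite_carrier_poly_quot:
  assumes "Q \<noteq> 0"
  shows "finite (carrier (poly_quot Q))"
proof -
  \<comment> \<open>Every class is represented by a remainder. The zero polynomial has degree 0, so
    for constant \<open>Q\<close> the strict degree bound would miss the remainder 0; hence the
    \<open>insert\<close>.\<close>
  have "poly_class Q p \<in> poly_class Q ` insert 0 {r. Polynomial.degree r < Polynomial.degree Q}" for p
  proof
    show "poly_class Q p = poly_class Q (p mod Q)"
      by (simp add: poly_class_eq_iff dvd_minus_mod)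
    show "p mod Q \<in> insert 0 {r. Polynomial.degree r < Polynomial.degree Q}"
      using degree_mod_less[OF assms, of p] by auto
  qed
  then have "carrier (poly_quot Q)
      \<subseteq> poly_class Q ` insert 0 {r. Polynomial.degree r < Polynomial.degree Q}"
    unfolding carrier_poly_quot by blast
  then show ?thesis by (rule finite_subset) (simp add: finite_degree_less)
qed


section \<open>Averages over a finite commutative ring\<close>

lemma average_cong: "(\<And>x. x \<in> S \<Longrightarrow> f x = g x) \<Longrightarrow> average S f = average S g"
  by (simp add: average_def)

lemma average_const: "finite S \<Longrightarrow> S \<noteq> {} \<Longrightarrow> average S (\<lambda>_. c) = c"
  by (simp add: average_def)

lemma average_reindex: "bij_betw h S S \<Longrightarrow> average S (\<lambda>x. f (h x)) = average S f"
  using sum.reindex_bij_betw[of h S S f] by (simp add: average_def)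

lemma norm_average_le:
  assumes "finite S" "S \<noteq> {}" "\<And>x. x \<in> S \<Longrightarrow> norm (f x) \<le> C"
  shows "norm (average S f) \<le> C"
proof -
  have "norm (\<Sum>x\<in>S. f x) \<le> real (card S) * C"
    using sum_norm_le[of S f "\<lambda>_. C"] assms(3) by simp
  moreover have "0 < card S" using assms(1,2) by (simp add: card_gt_0_iff)
  ultimately show ?thesis
    by (simp add: average_def norm_divide divide_le_eq mult.commute)
qed

lemma Lnorm_cong: "(\<And>x. x \<in> S \<Longrightarrow> f x = g x) \<Longrightarrow> Lnorm r S f = Lnorm r S g"
  by (simp add: Lnorm_def average_def)

lemma Lnorm_2: "Lnorm 2 S f = sqrt (average S (\<lambda>x. (cmod (f x))\<^sup>2))"
proof -
  have "cmod (f x) powr 2 = (cmod (f x))\<^sup>2" for x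
    by (cases "f x = 0") simp_all
  moreover have "0 \<le> average S (\<lambda>x. (cmod (f x))\<^sup>2)"
    by (simp add: average_def sum_nonneg)
  ultimately show ?thesis
    by (simp add: Lnorm_def powr_half_sqrt)
qed

lemma Lnorm_2_le:
  assumes "finite S" "S \<noteq> {}" "0 \<le> C" "\<And>x. x \<in> S \<Longrightarrow> cmod (f x) \<le> C"
  shows "Lnorm 2 S f \<le> C"
proof -
  have "norm (average S (\<lambda>x. (cmod (f x))\<^sup>2)) \<le> C\<^sup>2"
    using assms by (intro norm_average_le) (auto simp: power_mono)
  then have "sqrt (average S (\<lambda>x. (cmod (f x))\<^sup>2)) \<le> sqrt (C\<^sup>2)"
    by (intro real_sqrt_le_mono) simp
  then show ?thesis using assms(3) by (simp add: Lnorm_2)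
qed

text \<open>Being an input abbreviation, it makes the expression in the final theorem literally an
  instance, so facts about abstract finite rings apply there without unfolding.\<close>

abbreviation (input) deviation :: "('r, 'm) ring_scheme \<Rightarrow> 'r \<Rightarrow> ('r \<Rightarrow> complex) \<Rightarrow> real" where
  "deviation R a f \<equiv> Lnorm 2 (carrier R)
     (\<lambda>x. average (carrier R) (\<lambda>y. f (x \<oplus>\<^bsub>R\<^esub> a \<otimes>\<^bsub>R\<^esub> y)) - average (carrier R) f)"

context cring
begin

text \<open>Two averages of modulus at most 1 differ by at most 2. The purpose is boundedness: it
  makes the real supremum over \<open>f\<close> an upper bound for each single deviation.\<close>

lemma deviation_le:
  assumes "finite (carrier R)" "a \<in> carrier R" "f \<in> carrier R \<rightarrow> cball 0 1"
  shows "deviation R a f \<le> 2"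
proof (rule Lnorm_2_le)
  have f: "cmod (f x) \<le> 1" if "x \<in> carrier R" for x
    using assms(3) that by (auto simp: Pi_iff)
  fix x assume x: "x \<in> carrier R"
  have ne: "carrier R \<noteq> {}" using one_closed by blast
  have "cmod (average (carrier R) (\<lambda>y. f (x \<oplus> a \<otimes> y))) \<le> 1"
    using assms x f ne by (intro norm_average_le) auto
  moreover have "cmod (average (carrier R) f) \<le> 1"
    using assms f ne by (intro norm_average_le) auto
  ultimately show "cmod (average (carrier R) (\<lambda>y. f (x \<oplus> a \<otimes> y)) - average (carrier R) f) \<le> 2"
    using norm_triangle_ineq4[of "average (carrier R) (\<lambda>y. f (x \<oplus> a \<otimes> y))" "average (carrier R) f"]
    by linarith
qed (use assms one_closed in auto)

lemma deviation_le_SUP: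
  assumes "finite (carrier R)" "a \<in> carrier R" "f \<in> carrier R \<rightarrow> cball 0 1"
  shows "deviation R a f \<le> (SUP f \<in> carrier R \<rightarrow> cball 0 1. deviation R a f)"
  using deviation_le[OF assms(1,2)] assms(3) by (intro cSUP_upper bdd_aboveI2)

text \<open>On a finite carrier an injective self-map is a permutation, so cancellation by
  \<open>a\<close> suffices and no inverse of \<open>a\<close> has to be constructed.\<close>

lemma deviation_eq_0:
  assumes "finite (carrier R)" "a \<in> carrier R" "inj_on (\<lambda>y. a \<otimes> y) (carrier R)"
  shows "deviation R a f = 0"
proof -
  have "average (carrier R) (\<lambda>y. f (x \<oplus> a \<otimes> y)) = average (carrier R) f" if x: "x \<in> carrier R" for x
  proof -
    have "inj_on (\<lambda>y. x \<oplus> a \<otimes> y) (carrier R)"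
      using assms(2,3) x by (auto simp: inj_on_def)
    moreover have "(\<lambda>y. x \<oplus> a \<otimes> y) ` carrier R \<subseteq> carrier R"
      using assms(2) x by auto
    ultimately have "bij_betw (\<lambda>y. x \<oplus> a \<otimes> y) (carrier R) (carrier R)"
      using assms(1) unfolding bij_betw_def by (metis endo_inj_surj)
    then show ?thesis by (rule average_reindex)
  qed
  then have "deviation R a f = Lnorm 2 (carrier R) (\<lambda>_. 0)" by (intro Lnorm_cong) simp
  also have "\<dots> = 0" by (simp add: Lnorm_2 average_def)
  finally show ?thesis .
qed

text \<open>
  Translation by \<open>\<one>\<close> moves a proper ideal off itself, and at one of the points \<open>x\<close>, \<open>x \<oplus> \<one>\<close> the
  indicator is at distance at least \<open>1/2\<close> from any constant.
\<close>
lemma deviation_indicator_ge: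
  assumes fin: "finite (carrier R)" and a: "a \<in> carrier R" and proper: "\<one> \<notin> PIdl a"
    and B: "finite B" "carrier R \<subseteq> (\<Union>b\<in>B. (\<lambda>i. b \<oplus> i) ` (PIdl a))"
  shows "sqrt (1 / (2 * real (card B))) \<le> deviation R a (indicator (PIdl a))"
proof -
  define I where "I = PIdl a"
  define e where "e = average (carrier R) (indicator I :: 'a \<Rightarrow> complex)"
  define g where "g x = (cmod (indicator I x - e))\<^sup>2" for x
  interpret I: ideal I R unfolding I_def using a by (rule cgenideal_ideal)
  have I: "I \<subseteq> carrier R" by (rule I.a_subset)
  then have finI: "finite I" using fin by (rule finite_subset)
  have add_iff: "x \<oplus> i \<in> I \<longleftrightarrow> x \<in> I" if "x \<in> carrier R" "i \<in> I" for x i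
  proof
    assume "x \<oplus> i \<in> I"
    then have "(x \<oplus> i) \<oplus> \<ominus> i \<in> I" using that(2) by blast
    moreover have "(x \<oplus> i) \<oplus> \<ominus> i = x" using that I by (simp add: a_assoc r_neg subset_iff)
    ultimately show "x \<in> I" by simp
  qed (use that in blast)
  \<comment> \<open>Multiples of \<open>a\<close> lie in \<open>I\<close>, so the inner average is
    over a constant, and the deviation becomes the L2 distance of the indicator from its mean
    \<open>e\<close>.\<close>
  have invariant: "average (carrier R) (\<lambda>y. indicator I (x \<oplus> a \<otimes> y)) = (indicator I x :: complex)"
    if x: "x \<in> carrier R" for x
  proof -
    have "a \<otimes> y \<in> I" if "y \<in> carrier R" for y
      unfolding I_def cgenideal_def using that m_comm[OF a that] by blast
    then have "average (carrier R) (\<lambda>y. indicator I (x \<oplus> a \<otimes> y))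
        = average (carrier R) (\<lambda>y. indicator I x :: complex)"
      using x by (intro average_cong) (simp add: indicator_def add_iff)
    also have "\<dots> = indicator I x" using fin one_closed by (intro average_const) auto
    finally show ?thesis .
  qed
  have dev: "deviation R a (indicator I) = sqrt (average (carrier R) g)"
  proof -
    have "deviation R a (indicator I) = Lnorm 2 (carrier R) (\<lambda>x. indicator I x - e)"
      by (intro Lnorm_cong) (simp add: invariant e_def)
    then show ?thesis by (simp add: Lnorm_2 g_def [abs_def])
  qed

  have shift: "\<one> \<oplus> x \<notin> I" if "x \<in> I" for x
    using add_iff[of \<one> x] that proper by (simp add: I_def)
  have inj: "inj_on (\<lambda>x. \<one> \<oplus> x) I" using I by (auto simp: inj_on_def)
  \<comment> \<open>The indicator is 1 at \<open>x\<close> and 0 at the translate. The constant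
    comes from \<open>(u + v)^2 \<le> 2 * (u^2 + v^2)\<close> with
    \<open>u + v \<ge> 1\<close>.\<close>
  have pair: "1 / 2 \<le> g x + g (\<one> \<oplus> x)" if "x \<in> I" for x
  proof -
    have "1 \<le> cmod (1 - e) + cmod e" using norm_triangle_ineq[of "1 - e" e] by simp
    then have "1 \<le> (cmod (1 - e) + cmod e)\<^sup>2" by simp
    also have "\<dots> \<le> 2 * ((cmod (1 - e))\<^sup>2 + (cmod e)\<^sup>2)"
      using zero_le_power2[of "cmod (1 - e) - cmod e"] by (simp add: power2_sum power2_diff)
    finally show ?thesis using that shift[OF that] by (simp add: g_def)
  qed
  \<comment> \<open>Since \<open>I\<close> and its translate are disjoint, summing the pair bound
    over \<open>I\<close> uses each point of the ring at most once.\<close>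
  have "real (card I) / 2 = (\<Sum>x\<in>I. 1 / 2)" by simp
  also have "\<dots> \<le> (\<Sum>x\<in>I. g x + g (\<one> \<oplus> x))" by (intro sum_mono pair)
  also have "\<dots> = sum g I + sum g ((\<lambda>x. \<one> \<oplus> x) ` I)"
    by (simp add: sum.distrib sum.reindex[OF inj])
  also have "\<dots> = sum g (I \<union> (\<lambda>x. \<one> \<oplus> x) ` I)"
    using finI shift by (intro sum.union_disjoint [symmetric]) auto
  also have "\<dots> \<le> sum g (carrier R)"
    using fin I by (intro sum_mono2) (auto simp: g_def)
  finally have sum_ge: "real (card I) / 2 \<le> sum g (carrier R)" .

  \<comment> \<open>The translates of \<open>I\<close> by \<open>B\<close> cover the ring, so
    \<open>I\<close> has density at least \<open>1 / card B\<close>.\<close>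
  have "card (carrier R) \<le> card (\<Union>b\<in>B. (\<lambda>i. b \<oplus> i) ` I)"
    using B finI by (intro card_mono) (auto simp: I_def)
  also have "\<dots> \<le> (\<Sum>b\<in>B. card ((\<lambda>i. b \<oplus> i) ` I))" using B(1) by (rule card_UN_le)
  also have "\<dots> \<le> (\<Sum>b\<in>B. card I)" using finI by (intro sum_mono card_image_le)
  finally have card_le: "real (card (carrier R)) \<le> real (card B) * real (card I)"
    by (simp flip: of_nat_mult)
  have pos: "0 < card (carrier R)" using fin one_closed by (auto simp: card_gt_0_iff)
  then have "0 < card B" using card_le by (cases "card B") auto
  then have "1 / (2 * real (card B)) \<le> average (carrier R) g"
    using sum_ge card_le pos by (simp add: average_def field_simps)
      (smt (verit, best) mult_left_mono of_nat_0_le_iff)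
  then show ?thesis using dev by (simp add: I_def)
qed

end


section \<open>The equivalence\<close>

text \<open>Injectivity of multiplication by the class of \<open>m\<close> says that
  \<open>Q dvd m * (p - q)\<close> forces \<open>Q dvd p - q\<close>, which is the cancellation
  lemma.\<close>

lemma deviation_poly_quot_eq_0:
  fixes Q m :: "'a :: {field, finite} poly"
  assumes "Q \<noteq> 0"
    and "\<And>P. Polynomial.lead_coeff P = 1 \<Longrightarrow> irreducible P \<Longrightarrow> P dvd Q \<Longrightarrow> \<not> P dvd m"
  shows "deviation (poly_quot Q) (poly_class Q m) f = 0"
proof (rule cring.deviation_eq_0[OF cring_poly_quot finite_carrier_poly_quot[OF assms(1)]])
  show "poly_class Q m \<in> carrier (poly_quot Q)" by (simp add: carrier_poly_quot)
  have "poly_class Q p = poly_class Q q"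
    if "poly_class Q (m * p) = poly_class Q (m * q)" for p q
    using that dvd_mult_cancel_no_common_factor[of Q m "p - q"] assms
    by (simp add: poly_class_eq_iff right_diff_distrib)
  then show "inj_on (\<lambda>y. poly_class Q m \<otimes>\<^bsub>poly_quot Q\<^esub> y) (carrier (poly_quot Q))"
    unfolding inj_on_def carrier_poly_quot by (metis poly_class_mult rangeE)
qed

text \<open>Division with remainder by \<open>m\<close> covers the quotient by translates of the
  ideal of multiples of \<open>m\<close>, one for each remainder. Their number is bounded in terms
  of \<open>m\<close> alone, so the lower bound is uniform in \<open>Q\<close>.\<close>

lemma SUP_deviation_poly_quot_ge:
  fixes Q m P :: "'a :: {field, finite} poly"
  assumes "Q \<noteq> 0" "m \<noteq> 0" "irreducible P" "P dvd Q" "P dvd m"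
  shows "sqrt (1 / (2 * real (card (insert 0 {r :: 'a poly. Polynomial.degree r < Polynomial.degree m}))))
    \<le> (SUP f \<in> carrier (poly_quot Q) \<rightarrow> cball 0 1. deviation (poly_quot Q) (poly_class Q m) f)"
proof -
  interpret cring "poly_quot Q" by (rule cring_poly_quot)
  let ?R = "poly_quot Q" and ?a = "poly_class Q m"
  define D where "D = insert 0 {r :: 'a poly. Polynomial.degree r < Polynomial.degree m}"
  have finD: "finite D" by (simp add: D_def finite_degree_less)
  have fin: "finite (carrier ?R)" using assms(1) by (rule finite_carrier_poly_quot)
  have a: "?a \<in> carrier ?R" by (simp add: carrier_poly_quot)
  have PIdl: "PIdl\<^bsub>?R\<^esub> ?a = range (\<lambda>p. poly_class Q (p * m))"
    by (auto simp: cgenideal_def carrier_poly_quot poly_class_mult)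
  \<comment> \<open>If 1 were a multiple of \<open>m\<close> modulo \<open>Q\<close>, then reducing
    modulo the common factor \<open>P\<close> would make \<open>P\<close> a unit.\<close>
  have "\<one>\<^bsub>?R\<^esub> \<notin> PIdl\<^bsub>?R\<^esub> ?a"
  proof
    assume "\<one>\<^bsub>?R\<^esub> \<in> PIdl\<^bsub>?R\<^esub> ?a"
    then obtain p where "Q dvd 1 - p * m"
      by (auto simp: PIdl poly_class_eq_iff simp flip: poly_class_one)
    then have "P dvd 1 - p * m" using assms(4) by (rule dvd_trans[rotated])
    then have "P dvd (1 - p * m) + p * m" using assms(5) by (intro dvd_add dvd_mult)
    then show False using irreducible_not_unit[OF assms(3)] by simp
  qed
  moreover have "carrier ?R \<subseteq> (\<Union>b\<in>poly_class Q ` D. (\<lambda>i. b \<oplus>\<^bsub>?R\<^esub> i) ` (PIdl\<^bsub>?R\<^esub> ?a))"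
  proof
    fix x assume "x \<in> carrier ?R"
    then obtain p where "x = poly_class Q p" by (auto simp: carrier_poly_quot)
    then have "x = poly_class Q (p mod m) \<oplus>\<^bsub>?R\<^esub> poly_class Q (p div m * m)"
      by (simp flip: poly_class_add)
    moreover have "p mod m \<in> D" using degree_mod_less[OF assms(2), of p] by (auto simp: D_def)
    ultimately show "x \<in> (\<Union>b\<in>poly_class Q ` D. (\<lambda>i. b \<oplus>\<^bsub>?R\<^esub> i) ` (PIdl\<^bsub>?R\<^esub> ?a))"
      unfolding PIdl by blast
  qed
  ultimately have "sqrt (1 / (2 * real (card (poly_class Q ` D))))
      \<le> deviation ?R ?a (indicator (PIdl\<^bsub>?R\<^esub> ?a))"
    using fin a finD by (intro deviation_indicator_ge) auto
  also have "\<dots> \<le> (SUP f \<in> carrier ?R \<rightarrow> cball 0 1. deviation ?R ?a f)"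
    using fin a by (rule deviation_le_SUP) (auto simp: indicator_def)
  finally have *: "sqrt (1 / (2 * real (card (poly_class Q ` D))))
      \<le> (SUP f \<in> carrier ?R \<rightarrow> cball 0 1. deviation ?R ?a f)" .
  \<comment> \<open>Remainders modulo \<open>m\<close> may coincide modulo \<open>Q\<close>; fewer
    translates only improve the bound. Positivity excludes division by zero.\<close>
  have "0 < card (poly_class Q ` D)" using finD by (simp add: card_gt_0_iff D_def)
  moreover have "card (poly_class Q ` D) \<le> card D" using finD by (rule card_image_le)
  ultimately have "sqrt (1 / (2 * real (card D))) \<le> sqrt (1 / (2 * real (card (poly_class Q ` D))))"
    by (intro real_sqrt_le_mono divide_left_mono) auto
  with * show ?thesis unfolding D_def by linarith
qed

theorem theorem1p5:
  fixes Q :: "nat \<Rightarrow> 'a :: {field, finite} poly"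
  assumes "\<And>n. Polynomial.lead_coeff (Q n) = 1"
  shows
    "(\<forall>m :: 'a poly. m \<noteq> 0 \<longrightarrow>
        (\<lambda>n. SUP f \<in> carrier (poly_quot (Q n)) \<rightarrow> cball (0 :: complex) 1.
               Lnorm 2 (carrier (poly_quot (Q n)))
                 (\<lambda>x. average (carrier (poly_quot (Q n)))
                         (\<lambda>y. f (x \<oplus>\<^bsub>poly_quot (Q n)\<^esub> poly_class (Q n) m \<otimes>\<^bsub>poly_quot (Q n)\<^esub> y))
                       - average (carrier (poly_quot (Q n))) f))
          \<longlonglongrightarrow> 0)
     \<longleftrightarrow> (\<lambda>n. lpf (Q n)) \<longlonglongrightarrow> \<infinity>"
proof -
  have nz: "Q n \<noteq> 0" for n using assms[of n] by auto
  let ?S = "\<lambda>m n. SUP f \<in> carrier (poly_quot (Q n)) \<rightarrow> cball (0 :: complex) 1.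
    deviation (poly_quot (Q n)) (poly_class (Q n) m) f"
  have "(\<forall>m. m \<noteq> 0 \<longrightarrow> ?S m \<longlonglongrightarrow> 0) \<longleftrightarrow> (\<lambda>n. lpf (Q n)) \<longlonglongrightarrow> \<infinity>"
  proof (intro iffI allI impI)
    assume lim: "\<forall>m. m \<noteq> 0 \<longrightarrow> ?S m \<longlonglongrightarrow> 0"
    have "\<forall>\<^sub>F n in sequentially. ereal C \<le> lpf (Q n)" for C
    proof -
      \<comment> \<open>Scalar multiples are kept: it only matters that \<open>m\<close> is nonzero
        and divisible by every irreducible of absolute value at most \<open>C\<close>.\<close>
      define A where "A = {P :: 'a poly. irreducible P \<and> poly_abs P \<le> C}"
      define m where "m = \<Prod>A"
      have finA: "finite A"
        unfolding A_def using finite_poly_abs_le[of C] by (rule finite_subset[rotated]) auto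
      have "m \<noteq> 0" unfolding m_def using finA by (auto simp: A_def)
      \<comment> \<open>For small \<open>C\<close> the set \<open>A\<close> is empty and
        \<open>m = 1\<close>; the inserted 0 keeps the cardinality, and with it \<open>?c\<close>,
        positive.\<close>
      have "0 < sqrt (1 / (2 * real (card (insert 0
          {r :: 'a poly. Polynomial.degree r < Polynomial.degree m}))))" (is "0 < ?c")
        by (simp add: card_gt_0_iff finite_degree_less card.insert_remove)
      with lim \<open>m \<noteq> 0\<close> have "\<forall>\<^sub>F n in sequentially. ?S m n < ?c"
        by (intro order_tendstoD(2)[where y = 0]) auto
      then show ?thesis
      proof eventually_elim
        case (elim n)
        show ?case
          unfolding lpf_def
        proof (rule INF_greatest, clarify)
          fix P assume P: "irreducible P" "P dvd Q n"
          \<comment> \<open>A common factor of \<open>Q n\<close> and \<open>m\<close> would push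
            the supremum up to at least \<open>?c\<close>.\<close>
          have "\<not> P dvd m"
            using SUP_deviation_poly_quot_ge[OF nz \<open>m \<noteq> 0\<close> P] elim by linarith
          then have "P \<notin> A" using finA unfolding m_def by (auto intro: dvd_prodI[where f = "\<lambda>x. x"])
          then show "ereal C \<le> ereal (poly_abs P)" using P(1) by (simp add: A_def)
        qed
      qed
    qed
    then show "(\<lambda>n. lpf (Q n)) \<longlonglongrightarrow> \<infinity>"
      by (simp add: tendsto_PInfty_eq_at_top Lim_PInfty eventually_sequentially)
  next
    fix m :: "'a poly"
    assume lim: "(\<lambda>n. lpf (Q n)) \<longlonglongrightarrow> \<infinity>" and "m \<noteq> 0"
    \<comment> \<open>Beyond the threshold \<open>poly_abs m\<close>, each irreducible factor of
      \<open>Q n\<close> is too large to divide \<open>m\<close>.\<close>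
    from lim have "\<forall>\<^sub>F n in sequentially. ereal (poly_abs m) < lpf (Q n)"
      by (rule order_tendstoD) simp
    then have "\<forall>\<^sub>F n in sequentially. ?S m n = 0"
    proof eventually_elim
      case (elim n)
      have "\<not> P dvd m"
        if "Polynomial.lead_coeff P = 1" "irreducible P" "P dvd Q n" for P
        using less_lpfD[OF elim that] poly_abs_dvd_le[of P m] \<open>m \<noteq> 0\<close> by auto
      then have "deviation (poly_quot (Q n)) (poly_class (Q n) m) f = 0" for f
        using nz by (intro deviation_poly_quot_eq_0)
      \<comment> \<open>The index set has to be nonempty for the supremum of the constant 0 to be
        0.\<close>
      moreover have "(\<lambda>_. 0) \<in> carrier (poly_quot (Q n)) \<rightarrow> cball (0 :: complex) 1" by simp
      ultimately show ?case by (auto intro!: cSUP_const)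
    qed
    then show "?S m \<longlonglongrightarrow> 0" by (rule tendsto_eventually)
  qed
  then show ?thesis .
qed

end
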